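(* Let $\mathsf{com}$ be a communication model with $\mathrm{Exec}(\mathsf{com})\supseteq \mathrm{Exec}(\mathsf{synch})$. If a global type $G$ is deadlock-free realisable in $\mathsf{com}$, then $G$ is deadlock-free realisable in $\mathsf{synch}$.
   Context: Fix a finite set $P$ of processes and a finite set $\mathbb M$ of messages. Actions are send actions $p!q(m)$ (executed by $p$: $p$ sends $m$ to $q$) and receive actions $p?q(m)$ (executed by $q$: $q$ receives $m$ from $p$); $\mathrm{Act}$ is the set of actions and $\mathrm{Act}_p$ the set of actions executed by $p$. An event of a word $w\in \mathrm{Act}^*$ is a position of $w$. An execution is a pair $e=(w,\mathrm{src})$ with $w\in \mathrm{Act}^*$ and $\mathrm{src}$ an injective function from the receive events of $w$ to the send events of $w$ such that a receive event $r$ labelled $p?q(m)$ has $\mathrm{src}(r)<r$ and $\mathrm{src}(r)$ labelled $p!q(m)$. $e_1=(w_1,\mathrm{src}_1)$ is a prefix of $e_2=(w_2,\mathrm{src}_2)$ if $w_1$ is a prefix of $w_2$ and $\mathrm{src}_1$ is the restriction of $\mathrm{src}_2$. A communication model $\mathsf{com}$ is a set $\mathrm{Exec}(\mathsf{com})$ of executions. $\mathrm{Exec}(\mathsf{synch})$ is the set of executions in which, for every send event $s$, $s+1$ is a receive event with $\mathrm{src}(s+1)=s$. An MSC is a pair $M=((w_p)_{p\in P},\mathrm{src})$ with $w_p\in \mathrm{Act}_p^*$; its events are pairs ($p$, position in $w_p$), and $\mathrm{src}$ is an injective map from receive events to send events such that a receive event labelled $p?q(m)$ is mapped to a send event labelled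 $p!q(m)$. For an execution $e=(w,\mathrm{src})$, $\mathrm{msc}(e)$ is the MSC whose $w_p$ is the subsequence $e|_p$ of actions of $p$ in $w$, with $\mathrm{src}$ transported. The linearisations of $M$ are the executions $e$ with $\mathrm{msc}(e)=M$; $\mathrm{Lin}_{\mathsf{com}}(M)$ is the set of those lying in $\mathrm{Exec}(\mathsf{com})$. A system of CFSMs is a tuple $S=(A_p)_{p\in P}$ where $A_p$ is an NFA with $\varepsilon$-transitions over $\mathrm{Act}_p$. $\mathrm{Exec}(S,\mathsf{com})$ is the set of $e\in \mathrm{Exec}(\mathsf{com})$ with $e|_p\in L(A_p)$ for all $p$. $S^{acc}$ is $S$ with all states made accepting. $S$ is deadlock-free in $\mathsf{com}$ if every $e\in \mathrm{Exec}(S^{acc},\mathsf{com})$ is a prefix of some $e'\in \mathrm{Exec}(S,\mathsf{com})$. An arrow is a triple $p\to q{:}m$ with $p\neq q$ in $P$, $m\in\mathbb M$; $\mathrm{Arr}$ is the finite set of arrows. A global type $G$ is a deterministic finite automaton over $\mathrm{Arr}$. For $w\in \mathrm{Arr}^*$, $\mathrm{msc}(w)$ is the MSC of the synchronous execution obtained by replacing each arrow $p\to q{:}m$ by $p!q(m)\cdot p?q(m)$; $\mathcal L_\exists(G)=\{\mathrm{msc}(w)\mid w\in L(G)\}$ and $\mathrm{Exec}(G,\mathsf{com})=\bigcup\{\mathrm{Lin}_{\mathsf{com}}(M)\mid M\in\mathcal L_\exists(G)\}$. The projection $\mathrm{proj}(G)=(G_p)_{p\in P}$ is the system where $G_p$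 is obtained from $G$ by replacing each transition label $q\to r{:}m$ by $p!r(m)$ if $p=q$, by $q?p(m)$ if $p=r$, and by $\varepsilon$ otherwise. $G$ is deadlock-free realisable in $\mathsf{com}$ if (CC) $\mathrm{Exec}(\mathrm{proj}(G),\mathsf{com})=\mathrm{Exec}(G,\mathsf{com})$ and (DF) $\mathrm{proj}(G)$ is deadlock-free in $\mathsf{com}$. *)

theory Defs
  imports Main "HOL-Library.Sublist"
begin

text \<open>The finite sets of processes and messages are the universes of the type parameters
  \<open>'p\<close> and \<open>'m\<close>, which are required to be of class \<open>finite\<close> in the theorem.\<close>

section \<open>Executions\<close>

text \<open>\<open>Send p q m\<close> is $p!q(m)$ and \<open>Recv p q m\<close> is $p?q(m)$: in both, \<open>p\<close> is the
  sender and \<open>q\<close> the receiver.\<close>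

datatype ('p, 'm) action = Send 'p 'p 'm | Recv 'p 'p 'm

fun actor :: "('p, 'm) action \<Rightarrow> 'p" where
  "actor (Send p q m) = p"
| "actor (Recv p q m) = q"

definition Act_of :: "'p \<Rightarrow> ('p, 'm) action set" where
  "Act_of p = {a. actor a = p}"

fun is_send :: "('p, 'm) action \<Rightarrow> bool" where
  "is_send (Send p q m) = True"
| "is_send (Recv p q m) = False"

fun matches :: "('p, 'm) action \<Rightarrow> ('p, 'm) action \<Rightarrow> bool" where
  "matches (Send p q m) (Recv p' q' m') = (p = p' \<and> q = q' \<and> m = m')"
| "matches _ _ = False"

definition send_events :: "('p, 'm) action list \<Rightarrow> nat set" where
  "send_events w = {i. i < length w \<and> is_send (w ! i)}"

definition recv_events :: "('p, 'm) action list \<Rightarrow> nat set" where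
  "recv_events w = {i. i < length w \<and> \<not> is_send (w ! i)}"

text \<open>The function \<open>src\<close> is a partial map on positions (counted from 0), undefined outside the
  receive events, so that equality of pairs is equality of executions.\<close>

type_synonym ('p, 'm) execution = "('p, 'm) action list \<times> (nat \<rightharpoonup> nat)"

definition is_execution :: "('p, 'm) execution \<Rightarrow> bool" where
  "is_execution e \<longleftrightarrow> (case e of (w, src) \<Rightarrow>
     dom src = recv_events w \<and> ran src \<subseteq> send_events w \<and> inj_on src (dom src) \<and>
     (\<forall>r s. src r = Some s \<longrightarrow> s < r \<and> matches (w ! s) (w ! r)))"

definition exec_prefix :: "('p, 'm) execution \<Rightarrow> ('p, 'm) execution \<Rightarrow> bool" where
  "exec_prefix e\<^sub>1 e\<^sub>2 \<longleftrightarrow>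
     prefix (fst e\<^sub>1) (fst e\<^sub>2) \<and> snd e\<^sub>1 = snd e\<^sub>2 |` recv_events (fst e\<^sub>1)"

text \<open>A communication model is identified with its set of executions.\<close>

definition comm_model :: "('p, 'm) execution set \<Rightarrow> bool" where
  "comm_model com \<longleftrightarrow> (\<forall>e\<in>com. is_execution e)"

definition synch :: "('p, 'm) execution set" where
  "synch = {(w, src). is_execution (w, src) \<and>
     (\<forall>s\<in>send_events w. Suc s \<in> recv_events w \<and> src (Suc s) = Some s)}"

section \<open>Message sequence charts\<close>

type_synonym 'p event = "'p \<times> nat"

type_synonym ('p, 'm) msc = "('p \<Rightarrow> ('p, 'm) action list) \<times> ('p event \<rightharpoonup> 'p event)"

definition is_msc :: "('p, 'm) msc \<Rightarrow> bool" where
  "is_msc M \<longleftrightarrow> (case M of (w, src) \<Rightarrow>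
     (\<forall>p. w p \<in> lists (Act_of p)) \<and>
     dom src = {(p, i). i \<in> recv_events (w p)} \<and>
     ran src \<subseteq> {(p, i). i \<in> send_events (w p)} \<and>
     inj_on src (dom src) \<and>
     (\<forall>q j p i. src (q, j) = Some (p, i) \<longrightarrow> matches (w p ! i) (w q ! j)))"

definition restrict_word :: "('p, 'm) action list \<Rightarrow> 'p \<Rightarrow> ('p, 'm) action list" where
  "restrict_word w p = filter (\<lambda>a. actor a = p) w"

text \<open>\<open>positions w p\<close> lists the positions of the actions of \<open>p\<close> in \<open>w\<close> in increasing order, so
  the event \<open>(p, k)\<close> of the MSC comes from the position \<open>positions w p ! k\<close>. Conversely,
  \<open>event_at w i\<close> is the MSC event arising from position \<open>i\<close>.\<close>

definition positions :: "('p, 'm) action list \<Rightarrow> 'p \<Rightarrow> nat list" where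
  "positions w p = filter (\<lambda>i. actor (w ! i) = p) [0..<length w]"

definition event_at :: "('p, 'm) action list \<Rightarrow> nat \<Rightarrow> 'p event" where
  "event_at w i = (actor (w ! i), length (restrict_word (take i w) (actor (w ! i))))"

definition msc_of :: "('p, 'm) execution \<Rightarrow> ('p, 'm) msc" where
  "msc_of e = (case e of (w, src) \<Rightarrow>
     (restrict_word w,
      \<lambda>(p, k). if k < length (positions w p)
               then map_option (event_at w) (src (positions w p ! k)) else None))"

definition Lin :: "('p, 'm) execution set \<Rightarrow> ('p, 'm) msc \<Rightarrow> ('p, 'm) execution set" where
  "Lin com M = {e \<in> com. msc_of e = M}"

section \<open>Automata\<close>

text \<open>The label \<open>None\<close> stands for $\varepsilon$.\<close>

record ('q, 'a) nfa =
  states :: "'q set"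
  initial :: 'q
  accepting :: "'q set"
  delta :: "('q \<times> 'a option \<times> 'q) set"

definition is_nfa :: "'a set \<Rightarrow> ('q, 'a) nfa \<Rightarrow> bool" where
  "is_nfa \<Sigma> A \<longleftrightarrow> finite (states A) \<and> initial A \<in> states A \<and> accepting A \<subseteq> states A \<and>
     delta A \<subseteq> states A \<times> insert None (Some ` \<Sigma>) \<times> states A"

text \<open>The transition function of a deterministic automaton may be partial.\<close>

definition is_dfa :: "'a set \<Rightarrow> ('q, 'a) nfa \<Rightarrow> bool" where
  "is_dfa \<Sigma> A \<longleftrightarrow> is_nfa \<Sigma> A \<and> (\<forall>s s'. (s, None, s') \<notin> delta A) \<and>
     (\<forall>s a s' s''. (s, a, s') \<in> delta A \<longrightarrow> (s, a, s'') \<in> delta A \<longrightarrow> s' = s'')"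

inductive run :: "('q, 'a) nfa \<Rightarrow> 'q \<Rightarrow> 'a list \<Rightarrow> 'q \<Rightarrow> bool" for A where
  run_Nil: "run A s [] s"
| run_eps: "(s, None, s') \<in> delta A \<Longrightarrow> run A s' w t \<Longrightarrow> run A s w t"
| run_step: "(s, Some a, s') \<in> delta A \<Longrightarrow> run A s' w t \<Longrightarrow> run A s (a # w) t"

definition lang :: "('q, 'a) nfa \<Rightarrow> 'a list set" where
  "lang A = {w. \<exists>t\<in>accepting A. run A (initial A) w t}"

section \<open>Systems of communicating automata\<close>

type_synonym ('q, 'p, 'm) cfsms = "'p \<Rightarrow> ('q, ('p, 'm) action) nfa"

definition is_system :: "('q, 'p, 'm) cfsms \<Rightarrow> bool" where
  "is_system S \<longleftrightarrow> (\<forall>p. is_nfa (Act_of p) (S p))"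

definition Exec :: "('q, 'p, 'm) cfsms \<Rightarrow> ('p, 'm) execution set \<Rightarrow> ('p, 'm) execution set" where
  "Exec S com = {e \<in> com. \<forall>p. restrict_word (fst e) p \<in> lang (S p)}"

definition all_accepting :: "('q, 'p, 'm) cfsms \<Rightarrow> ('q, 'p, 'm) cfsms" where
  "all_accepting S = (\<lambda>p. (S p)\<lparr>accepting := states (S p)\<rparr>)"

definition deadlock_free :: "('q, 'p, 'm) cfsms \<Rightarrow> ('p, 'm) execution set \<Rightarrow> bool" where
  "deadlock_free S com \<longleftrightarrow>
     (\<forall>e \<in> Exec (all_accepting S) com. \<exists>e' \<in> Exec S com. exec_prefix e e')"

section \<open>Global types\<close>

datatype ('p, 'm) arrow = Arrow 'p 'p 'm

definition Arr :: "('p, 'm) arrow set" where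
  "Arr = {Arrow p q m | p q m. p \<noteq> q}"

type_synonym ('q, 'p, 'm) global_type = "('q, ('p, 'm) arrow) nfa"

definition is_global_type :: "('q, 'p, 'm) global_type \<Rightarrow> bool" where
  "is_global_type G \<longleftrightarrow> is_dfa Arr G"

fun arrow_actions :: "('p, 'm) arrow \<Rightarrow> ('p, 'm) action list" where
  "arrow_actions (Arrow p q m) = [Send p q m, Recv p q m]"

definition exec_of_arrows :: "('p, 'm) arrow list \<Rightarrow> ('p, 'm) execution" where
  "exec_of_arrows w =
     (concat (map arrow_actions w),
      \<lambda>i. if i < 2 * length w \<and> odd i then Some (i - 1) else None)"

definition msc_of_arrows :: "('p, 'm) arrow list \<Rightarrow> ('p, 'm) msc" where
  "msc_of_arrows w = msc_of (exec_of_arrows w)"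

definition L_ex :: "('q, 'p, 'm) global_type \<Rightarrow> ('p, 'm) msc set" where
  "L_ex G = msc_of_arrows ` lang G"

definition Exec_global ::
  "('q, 'p, 'm) global_type \<Rightarrow> ('p, 'm) execution set \<Rightarrow> ('p, 'm) execution set" where
  "Exec_global G com = (\<Union>M\<in>L_ex G. Lin com M)"

fun proj_label :: "'p \<Rightarrow> ('p, 'm) arrow \<Rightarrow> ('p, 'm) action option" where
  "proj_label p (Arrow q r m) =
     (if p = q then Some (Send p r m) else if p = r then Some (Recv q p m) else None)"

definition proj :: "('q, 'p, 'm) global_type \<Rightarrow> ('q, 'p, 'm) cfsms" where
  "proj G = (\<lambda>p. \<lparr>states = states G, initial = initial G, accepting = accepting G,
     delta = {(s, proj_label p a, s') | s a s'. (s, Some a, s') \<in> delta G}\<rparr>)"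

definition df_realisable :: "('q, 'p, 'm) global_type \<Rightarrow> ('p, 'm) execution set \<Rightarrow> bool" where
  "df_realisable G com \<longleftrightarrow>
     Exec (proj G) com = Exec_global G com \<and> deadlock_free (proj G) com"

section \<open>The constructions yield objects of the intended kind\<close>

lemma is_system_proj:
  assumes "is_global_type G"
  shows "is_system (proj G)"
proof -
  have "proj_label p a \<in> insert None (Some ` Act_of p)" for p and a :: "('b, 'c) arrow"
    by (cases a) (auto simp: Act_of_def)
  moreover have "s \<in> states G \<and> s' \<in> states G" if "(s, a, s') \<in> delta G" for s a s'
    using assms that unfolding is_global_type_def is_dfa_def is_nfa_def by blast
  ultimately show ?thesis
    using assms unfolding is_system_def is_global_type_def is_dfa_def is_nfa_def proj_def
    by (simp del: insert_iff) blast
qed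

lemma length_concat_arrows: "length (concat (map arrow_actions w)) = 2 * length w"
proof (induction w)
  case (Cons a w)
  then show ?case by (cases a) auto
qed simp

lemma nth_concat_arrows:
  "k < length w \<Longrightarrow> concat (map arrow_actions w) ! (2 * k) = arrow_actions (w ! k) ! 0 \<and>
     concat (map arrow_actions w) ! Suc (2 * k) = arrow_actions (w ! k) ! 1"
proof (induction w arbitrary: k)
  case (Cons a w)
  then show ?case by (cases a; cases k) auto
qed simp

lemma exec_of_arrows_synch: "exec_of_arrows w \<in> synch"
proof -
  let ?u = "concat (map arrow_actions w)"
  have ev: "is_send (?u ! (2 * k)) \<and> \<not> is_send (?u ! Suc (2 * k)) \<and>
      matches (?u ! (2 * k)) (?u ! Suc (2 * k))" if "k < length w" for k
    using nth_concat_arrows[OF that] by (cases "w ! k") auto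
  have s: "i \<in> send_events ?u \<longleftrightarrow> i < 2 * length w \<and> even i" for i
    using ev[of "i div 2"] by (cases "even i")
      (auto simp: send_events_def length_concat_arrows elim!: evenE oddE)
  have r: "i \<in> recv_events ?u \<longleftrightarrow> i < 2 * length w \<and> odd i" for i
    using ev[of "i div 2"] by (cases "even i")
      (auto simp: recv_events_def length_concat_arrows elim!: evenE oddE)
  have m: "matches (?u ! (i - Suc 0)) (?u ! i)" if "odd i" "i < 2 * length w" for i
    using ev[of "i div 2"] that by (auto elim!: oddE)
  show ?thesis
    unfolding synch_def is_execution_def exec_of_arrows_def
    by (auto simp: s r m dom_def ran_def inj_on_def split: if_splits; presburger)
qed

lemma positions_snoc:
  "positions (w @ [a]) p = positions w p @ (if actor a = p then [length w] else [])"
  unfolding positions_def by (auto intro!: filter_cong simp: nth_append)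

lemma length_positions: "length (positions w p) = length (restrict_word w p)"
proof (induction w rule: rev_induct)
  case Nil
  then show ?case by (simp add: positions_def restrict_word_def)
next
  case (snoc a w)
  then show ?case by (simp add: positions_snoc restrict_word_def)
qed

lemma event_at_positions:
  assumes "k < length (positions w p)"
  shows "positions w p ! k < length w" "event_at w (positions w p ! k) = (p, k)"
    "restrict_word w p ! k = w ! (positions w p ! k)"
proof -
  have "positions w p ! k < length w \<and> event_at w (positions w p ! k) = (p, k) \<and>
      restrict_word w p ! k = w ! (positions w p ! k)"
    using assms
  proof (induction w rule: rev_induct)
    case (snoc a w)
    show ?case
    proof (cases "k < length (positions w p)")
      case True
      with snoc.IH show ?thesis
        using length_positions[of w p]
        by (auto simp: positions_snoc nth_append event_at_def restrict_word_def)
    next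
      case False
      with snoc.prems have "k = length (positions w p)" "actor a = p"
        by (auto simp: positions_snoc split: if_splits)
      then show ?thesis
        using length_positions[of w p]
        by (auto simp: positions_snoc nth_append event_at_def restrict_word_def)
    qed
  qed (simp add: positions_def)
  then show "positions w p ! k < length w" "event_at w (positions w p ! k) = (p, k)"
    "restrict_word w p ! k = w ! (positions w p ! k)" by auto
qed

lemma positions_event_at:
  assumes "i < length w" "event_at w i = (p, k)"
  shows "k < length (positions w p)" "positions w p ! k = i"
proof -
  have "i \<in> set (positions w p)"
    using assms by (auto simp: positions_def event_at_def)
  then obtain k' where "k' < length (positions w p)" "positions w p ! k' = i"
    by (auto simp: in_set_conv_nth)
  with event_at_positions(2)[of k' w p] assms(2)
  show "k < length (positions w p)" "positions w p ! k = i" by auto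
qed

lemma is_msc_msc_of:
  assumes "is_execution e"
  shows "is_msc (msc_of e)"
proof -
  obtain w src where e: "e = (w, src)" by (cases e)
  define src' where "src' = snd (msc_of e)"
  have src': "src' (q, j) = Some (p, i) \<longleftrightarrow>
      j < length (positions w q) \<and> i < length (positions w p) \<and>
      src (positions w q ! j) = Some (positions w p ! i)" for p q i j
  proof
    assume "src' (q, j) = Some (p, i)"
    then obtain s where s: "j < length (positions w q)" "src (positions w q ! j) = Some s"
      "event_at w s = (p, i)"
      by (auto simp: src'_def msc_of_def e split: if_splits)
    have "s < length w"
      using assms s(2) by (auto simp: is_execution_def e send_events_def ran_def)
    from positions_event_at[OF this s(3)] s
    show "j < length (positions w q) \<and> i < length (positions w p) \<and>
      src (positions w q ! j) = Some (positions w p ! i)" by auto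
  next
    assume "j < length (positions w q) \<and> i < length (positions w p) \<and>
      src (positions w q ! j) = Some (positions w p ! i)"
    then show "src' (q, j) = Some (p, i)"
      by (auto simp: src'_def msc_of_def e event_at_positions)
  qed
  have dom: "(q, j) \<in> dom src' \<longleftrightarrow> j \<in> recv_events (restrict_word w q)" for q j
  proof -
    have "(q, j) \<in> dom src' \<longleftrightarrow> j < length (positions w q) \<and> positions w q ! j \<in> dom src"
      by (auto simp: src'_def msc_of_def e split: if_splits)
    also have "dom src = recv_events w"
      using assms by (simp add: is_execution_def e)
    finally show ?thesis
      using event_at_positions[of j w q] by (auto simp: recv_events_def length_positions)
  qed
  have ran: "i \<in> send_events (restrict_word w p) \<and>
      matches (restrict_word w p ! i) (restrict_word w q ! j)"
    if "src' (q, j) = Some (p, i)" for p q i j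
  proof -
    from that have *: "j < length (positions w q)" "i < length (positions w p)"
      "src (positions w q ! j) = Some (positions w p ! i)" by (auto simp: src')
    then show ?thesis
      using assms event_at_positions[of i w p] event_at_positions[of j w q]
      by (auto simp: is_execution_def e send_events_def ran_def length_positions)
  qed
  have inj: "inj_on src' (dom src')"
  proof (rule inj_onI)
    fix x y assume "x \<in> dom src'" "y \<in> dom src'" "src' x = src' y"
    then obtain q j q' j' p i where xy: "x = (q, j)" "y = (q', j')"
      "src' (q, j) = Some (p, i)" "src' (q', j') = Some (p, i)"
      by (cases x; cases y) auto
    then have *: "j < length (positions w q)" "j' < length (positions w q')"
      "src (positions w q ! j) = Some (positions w p ! i)"
      "src (positions w q' ! j') = Some (positions w p ! i)" by (auto simp: src')
    have "inj_on src (dom src)"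
      using assms by (auto simp: is_execution_def e)
    from inj_onD[OF this, of "positions w q ! j" "positions w q' ! j'"]
    have "positions w q ! j = positions w q' ! j'"
      using *(3,4) by (simp add: domIff)
    then have "(q, j) = (q', j')"
      using event_at_positions(2)[OF *(1)] event_at_positions(2)[OF *(2)] by metis
    then show "x = y" by (simp add: xy)
  qed
  have "msc_of e = (restrict_word w, src')"
    by (simp add: src'_def msc_of_def e)
  moreover have "restrict_word w p \<in> lists (Act_of p)" for p
    by (auto simp: restrict_word_def Act_of_def)
  moreover have "ran src' \<subseteq> {(p, i). i \<in> send_events (restrict_word w p)}"
    using ran by (auto simp: ran_def)
  moreover have "dom src' = {(q, j). j \<in> recv_events (restrict_word w q)}"
    by (rule set_eqI) (simp only: split_paired_all dom mem_Collect_eq case_prod_conv)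
  ultimately show ?thesis
    using ran inj unfolding is_msc_def by (simp only: case_prod_conv) blast
qed

end

theory Submission imports Defs begin

text \<open>A synchronous execution is the execution of a word \<open>u\<close> of arrows. By deadlock-freedom and
  (CC) in \<open>com\<close>, the execution of \<open>u\<close> extends to a linearisation of the MSC of some \<open>w \<in> lang G\<close>,
  so that every projection of \<open>u\<close> is a prefix of that of \<open>w\<close>. Hence the letters of \<open>u\<close> can be
  moved one after another to the front of \<open>w\<close> by commuting arrows without common process, which
  does not change the MSC. The resulting \<open>u @ v\<close> gives the synchronous extension; it is an
  execution of the projection because it lies in \<open>com\<close>, where (CC) applies again.\<close>

section \<open>Projections and MSCs of arrow words\<close>

fun procs :: "('p, 'm) arrow \<Rightarrow> 'p set" where
  "procs (Arrow p q m) = {p, q}"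

definition arrow_proj :: "('p, 'm) arrow list \<Rightarrow> 'p \<Rightarrow> ('p, 'm) action list" where
  "arrow_proj w = restrict_word (concat (map arrow_actions w))"

lemma restrict_word_append [simp]: "restrict_word (v @ w) p = restrict_word v p @ restrict_word w p"
  by (simp add: restrict_word_def)

lemma arrow_proj_simps [simp]:
  "arrow_proj [] p = []"
  "arrow_proj (v @ w) p = arrow_proj v p @ arrow_proj w p"
  "arrow_proj (Arrow q r m # w) p =
     (if q = p then [Send q r m] else []) @ (if r = p then [Recv q r m] else []) @ arrow_proj w p"
  by (auto simp: arrow_proj_def restrict_word_def)

lemma fst_msc_of_arrows: "fst (msc_of_arrows w) = arrow_proj w"
  by (simp add: msc_of_arrows_def msc_of_def exec_of_arrows_def arrow_proj_def)

lemma event_at_append: "i < length v \<Longrightarrow> event_at (v @ w) i = event_at v i"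
  by (simp add: event_at_def nth_append)

text \<open>The new receive is the last event of \<open>q\<close> and its source the last event of
  \<open>p\<close>; all earlier events keep their numbers. With \<open>p = q\<close> the send would
  shift the number of the receive by one.\<close>

lemma snd_msc_of_arrows_snoc:
  fixes m :: 'm
  assumes "p \<noteq> q"
  shows "snd (msc_of_arrows (w @ [Arrow p q m])) =
    (snd (msc_of_arrows w))((q, length (arrow_proj w q)) \<mapsto> (p, length (arrow_proj w p)))"
proof (rule ext, clarify)
  fix r k
  define W where "W = concat (map arrow_actions w)"
  let ?W = "W @ [Send p q m] @ [Recv p q m]"
  define f :: "nat \<Rightarrow> nat \<Rightarrow> nat option" where
    "f = (\<lambda>n i. if i < 2 * n \<and> odd i then Some (i - 1) else None)"
  have len: "length W = 2 * length w"
    by (simp add: W_def length_concat_arrows)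
  have pos: "positions ?W r = positions W r @ (if p = r then [length W] else []) @
      (if q = r then [Suc (length W)] else [])" for r
    using positions_snoc[of "W @ [Send p q m]" "Recv p q m" r] positions_snoc[of W "Send p q m" r]
    by simp
  have L: "snd (msc_of_arrows (w @ [Arrow p q m])) (r, k) =
      (if k < length (positions ?W r)
       then map_option (event_at ?W) (f (Suc (length w)) (positions ?W r ! k)) else None)"
    by (simp add: msc_of_arrows_def msc_of_def exec_of_arrows_def W_def f_def)
  have R: "snd (msc_of_arrows w) (r, k) =
      (if k < length (positions W r)
       then map_option (event_at W) (f (length w) (positions W r ! k)) else None)"
    by (simp add: msc_of_arrows_def msc_of_def exec_of_arrows_def W_def f_def)
  have lenp: "length (arrow_proj w r) = length (positions W r)" for r
    by (simp add: arrow_proj_def W_def length_positions)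
  have "event_at ?W (length W) = (p, length (positions W p))"
    by (simp add: event_at_def length_positions)
  \<comment> \<open>A source lies before its receive, hence still inside \<open>W\<close>, where
    appending does not renumber events.\<close>
  moreover have "map_option (event_at ?W) (f (Suc (length w)) i) =
      map_option (event_at W) (f (length w) i)" if "i < length W" for i
    using that by (simp add: f_def len event_at_append)
  ultimately show "snd (msc_of_arrows (w @ [Arrow p q m])) (r, k) =
    ((snd (msc_of_arrows w))((q, length (arrow_proj w q)) \<mapsto> (p, length (arrow_proj w p)))) (r, k)"
    using assms event_at_positions(1)[of k W r]
    unfolding L lenp fun_upd_apply R pos
    by (auto simp: nth_append f_def len less_Suc_eq)
qed

section \<open>Congruence and commutation of independent arrows\<close>

text \<open>A further arrow acts on the source map only through the lengths of the projections,
  which are part of the MSC.\<close>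

lemma msc_of_arrows_snoc_cong:
  assumes "msc_of_arrows v = msc_of_arrows w" and "a \<in> Arr"
  shows "msc_of_arrows (v @ [a]) = msc_of_arrows (w @ [a])"
proof -
  obtain p q m where "a = Arrow p q m" "p \<noteq> q"
    using assms(2) by (auto simp: Arr_def)
  moreover have "arrow_proj v = arrow_proj w"
    using assms(1) by (metis fst_msc_of_arrows)
  ultimately show ?thesis
    using assms(1) by (intro prod_eqI) (auto simp: fst_msc_of_arrows snd_msc_of_arrows_snoc)
qed

lemma msc_of_arrows_append_cong:
  assumes "msc_of_arrows v = msc_of_arrows w" and "set z \<subseteq> Arr"
  shows "msc_of_arrows (v @ z) = msc_of_arrows (w @ z)"
  using assms(2)
proof (induction z rule: rev_induct)
  case (snoc a z)
  then show ?case
    using msc_of_arrows_snoc_cong[of "v @ z" "w @ z" a] by simp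
qed (simp add: assms(1))

text \<open>Neither arrow changes the projections that fix the source entry of the other, and the
  two entries have distinct receivers, so the updates commute.\<close>

lemma msc_of_arrows_swap:
  assumes "a \<in> Arr" "b \<in> Arr" "procs a \<inter> procs b = {}"
  shows "msc_of_arrows (v @ [a, b]) = msc_of_arrows (v @ [b, a])"
proof -
  obtain p q m r s n where ab: "a = Arrow p q m" "p \<noteq> q" "b = Arrow r s n" "r \<noteq> s"
    using assms(1,2) by (auto simp: Arr_def)
  have "snd (msc_of_arrows (v @ [a, b])) = snd (msc_of_arrows (v @ [b, a]))"
    using snd_msc_of_arrows_snoc[of p q "v @ [b]" m] snd_msc_of_arrows_snoc[of r s "v @ [a]" n]
      snd_msc_of_arrows_snoc[of p q v m] snd_msc_of_arrows_snoc[of r s v n] ab assms(3)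
    by (auto intro!: fun_upd_twist)
  moreover have "arrow_proj (v @ [a, b]) = arrow_proj (v @ [b, a])"
    using ab assms(3) by auto
  ultimately show ?thesis
    by (intro prod_eqI) (simp_all add: fst_msc_of_arrows)
qed

section \<open>Moving a word with prefix projections to the front\<close>

text \<open>The arrow \<open>a\<close> passes the letters of \<open>x\<close> from the right, one
  swap each. The letter passed joins \<open>y\<close>, which therefore varies in the
  induction.\<close>

lemma msc_of_arrows_move:
  assumes "a \<in> Arr" "set x \<subseteq> Arr" "set y \<subseteq> Arr" "\<forall>b\<in>set x. procs a \<inter> procs b = {}"
  shows "msc_of_arrows (v @ x @ a # y) = msc_of_arrows (v @ a # x @ y)"
  using assms(2,3,4)
proof (induction x arbitrary: y rule: rev_induct)
  case (snoc b x)
  then have "msc_of_arrows ((v @ x) @ [b, a]) = msc_of_arrows ((v @ x) @ [a, b])"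
    using assms(1) by (intro msc_of_arrows_swap) auto
  then have "msc_of_arrows (v @ x @ b # a # y) = msc_of_arrows (v @ x @ a # b # y)"
    using msc_of_arrows_append_cong snoc.prems(2) by fastforce
  then show ?case
    using snoc.IH[of "b # y"] snoc.prems by simp
qed simp

text \<open>The first arrow of \<open>w\<close> involving \<open>p\<close> and the first one involving \<open>q\<close> are the same, since
  each of them involves both processes.\<close>

lemma split_at_first_arrow:
  assumes "set w \<subseteq> Arr" and "\<And>r. prefix (arrow_proj [Arrow p q m] r) (arrow_proj w r)"
  obtains x y where "w = x @ Arrow p q m # y" "\<forall>b\<in>set x. procs (Arrow p q m) \<inter> procs b = {}"
proof -
  have "arrow_proj w p \<noteq> []"
    using assms(2)[of p] by auto
  then have "\<exists>b\<in>set w. p \<in> procs b"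
  proof (induction w)
    case (Cons b w)
    then show ?case by (cases b) (auto split: if_splits)
  qed simp
  then have "\<exists>b\<in>set w. procs (Arrow p q m) \<inter> procs b \<noteq> {}"
    by auto
  from split_list_first_prop[OF this] obtain x b y where w: "w = x @ b # y"
    "procs (Arrow p q m) \<inter> procs b \<noteq> {}" "\<forall>b\<in>set x. procs (Arrow p q m) \<inter> procs b = {}"
    by auto
  have "arrow_proj x r = []" if "r \<in> {p, q}" for r
    using w(3)
  proof (induction x)
    case (Cons b x)
    with that show ?case by (cases b) auto
  qed simp
  then have "prefix (arrow_proj [Arrow p q m] r) (arrow_proj (b # y) r)" if "r \<in> {p, q}" for r
    using assms(2)[of r] that by (simp add: w(1))
  \<comment> \<open>\<open>b\<close> supplies the first action of the projection to a process it
    shares with \<open>{p, q}\<close>. This action must be the first action of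
    \<open>Arrow p q m\<close> there, and an action determines its arrow.\<close>
  from this[of p] this[of q] have "b = Arrow p q m"
    using w(2) assms(1) by (cases b) (auto simp: w(1) Arr_def split: if_splits)
  with w that show ?thesis by blast
qed

text \<open>Induction along \<open>u\<close>, with \<open>v\<close> as what is left of
  \<open>w\<close>: the next letter of \<open>u\<close> occurs in \<open>v\<close> behind arrows
  independent of it only.\<close>

lemma msc_of_arrows_extend:
  assumes "set w \<subseteq> Arr" and "\<And>r. prefix (arrow_proj u r) (arrow_proj w r)"
  shows "\<exists>v. set v \<subseteq> Arr \<and> msc_of_arrows (u @ v) = msc_of_arrows w"
  using assms(2)
proof (induction u rule: rev_induct)
  case Nil
  show ?case using assms(1) by auto
next
  case (snoc a u)
  have "\<exists>v. set v \<subseteq> Arr \<and> msc_of_arrows (u @ v) = msc_of_arrows w"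
    by (rule snoc.IH) (use snoc.prems in \<open>auto dest: append_prefixD\<close>)
  then obtain v where v: "set v \<subseteq> Arr" "msc_of_arrows (u @ v) = msc_of_arrows w"
    by blast
  obtain p q m where a: "a = Arrow p q m"
    by (cases a)
  have "arrow_proj w = arrow_proj (u @ v)"
    using v(2) by (metis fst_msc_of_arrows)
  \<comment> \<open>The common prefix \<open>arrow_proj u r\<close> cancels.\<close>
  then have "prefix (arrow_proj [a] r) (arrow_proj v r)" for r
    using snoc.prems[of r] by simp
  from split_at_first_arrow[OF v(1) this[unfolded a]] obtain x y
    where xy: "v = x @ a # y" "\<forall>b\<in>set x. procs a \<inter> procs b = {}"
    unfolding a by metis
  \<comment> \<open>As a letter of \<open>v\<close>, the arrow \<open>a\<close> lies in
    \<open>Arr\<close>, so it may be moved.\<close>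
  then have "msc_of_arrows (u @ v) = msc_of_arrows (u @ a # x @ y)"
    using v(1) msc_of_arrows_move[of a x y u] by simp
  with v xy(1) show ?case
    by (intro exI[of _ "x @ y"]) simp
qed

section \<open>Synchronous executions as arrow words\<close>

text \<open>Each send is followed at once by its receive, and injectivity of \<open>src\<close>
  leaves room for no other receive, so the two kinds alternate.\<close>

lemma synch_parity:
  assumes "(w, src) \<in> synch"
  shows "i < length w \<Longrightarrow> is_send (w ! i) \<longleftrightarrow> even i"
    and "i < length w \<Longrightarrow> odd i \<Longrightarrow> src i = Some (i - 1)"
    and "even (length w)"
proof -
  have dom: "dom src = recv_events w" and ran: "ran src \<subseteq> send_events w"
    and inj: "inj_on src (dom src)" and less: "\<And>r s. src r = Some s \<Longrightarrow> s < r"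
    and next_recv: "\<And>s. s \<in> send_events w \<Longrightarrow> Suc s \<in> recv_events w \<and> src (Suc s) = Some s"
    using assms by (auto simp: synch_def is_execution_def)
  show parity: "is_send (w ! i) \<longleftrightarrow> even i" if "i < length w" for i
    using that
  proof (induction i rule: less_induct)
    case (less i)
    show ?case
    proof (cases "even i")
      case True
      have "is_send (w ! i)"
      proof (rule ccontr)
        assume "\<not> is_send (w ! i)"
        with less.prems dom have "i \<in> dom src"
          by (simp add: recv_events_def)
        then obtain s where s: "src i = Some s"
          by blast
        with ran have send: "s \<in> send_events w"
          by (auto simp: ran_def)
        \<comment> \<open>Both \<open>i\<close> and \<open>Suc s\<close> have source
          \<open>s\<close>, so injectivity identifies them. Then \<open>s\<close> is a send at a
          smaller odd position, against the induction hypothesis.\<close>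
        have "i = Suc s"
          using inj_onD[OF inj, of i "Suc s"] next_recv[OF send] s dom by (auto simp: domIff)
        with True send less show False
          by (auto simp: send_events_def)
      qed
      with True show ?thesis by simp
    next
      case False
      then obtain j where j: "i = Suc j" "even j"
        by (cases i) auto
      with less have "j \<in> send_events w"
        by (simp add: send_events_def)
      with next_recv j show ?thesis
        by (auto simp: recv_events_def)
    qed
  qed
  show "src i = Some (i - 1)" if "i < length w" "odd i"
    using next_recv[of "i - 1"] parity[of "i - 1"] that by (auto simp: send_events_def)
  show "even (length w)"
  proof (rule ccontr)
    assume "odd (length w)"
    \<comment> \<open>The last position would be even, hence a send, and its receive would fall
      outside the word.\<close>
    then have "length w - 1 \<in> send_events w"
      using parity[of "length w - 1"] odd_pos by (fastforce simp: send_events_def)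
    with next_recv have "Suc (length w - 1) \<in> recv_events w"
      by blast
    with \<open>odd (length w)\<close> show False
      by (auto simp: recv_events_def)
  qed
qed

text \<open>Positions \<open>2 * k\<close> and \<open>Suc (2 * k)\<close> together form one arrow.
  Sender and receiver of an action may coincide, so the letters of \<open>u\<close> need not lie in
  \<open>Arr\<close>.\<close>

lemma synch_imp_exec_of_arrows:
  assumes "e \<in> synch"
  obtains u where "e = exec_of_arrows u"
proof -
  obtain w src where e: "e = (w, src)"
    by (cases e)
  note parity = synch_parity[OF assms[unfolded e]]
  have dom: "dom src = recv_events w"
    and match: "\<And>r s. src r = Some s \<Longrightarrow> matches (w ! s) (w ! r)"
    using assms by (auto simp: e synch_def is_execution_def)
  define n where "n = length w div 2"
  have n: "length w = 2 * n"
    using parity(3) by (simp add: n_def)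
  have "\<exists>a. arrow_actions a = [w ! (2 * k), w ! Suc (2 * k)]" if "k < n" for k
  proof -
    have "matches (w ! (2 * k)) (w ! Suc (2 * k))"
      using match parity(2)[of "Suc (2 * k)"] that n by auto
    then obtain p q m where "w ! (2 * k) = Send p q m" "w ! Suc (2 * k) = Recv p q m"
      by (elim matches.elims) auto
    then have "arrow_actions (Arrow p q m) = [w ! (2 * k), w ! Suc (2 * k)]"
      by simp
    then show ?thesis ..
  qed
  then obtain f where f: "arrow_actions (f k) = [w ! (2 * k), w ! Suc (2 * k)]" if "k < n" for k
    by metis
  let ?u = "map f [0..<n]"
  have "w = concat (map arrow_actions ?u)"
  proof (rule nth_equalityI)
    show "length w = length (concat (map arrow_actions ?u))"
      by (simp only: length_concat_arrows n) simp
    fix i assume i: "i < length w"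
    have k: "i div 2 < n"
      using i n by simp
    have "concat (map arrow_actions ?u) ! (2 * (i div 2)) = w ! (2 * (i div 2))"
      "concat (map arrow_actions ?u) ! Suc (2 * (i div 2)) = w ! Suc (2 * (i div 2))"
      using nth_concat_arrows[of "i div 2" ?u] f[OF k] k by simp_all
    then show "w ! i = concat (map arrow_actions ?u) ! i"
      by (cases "even i") (simp_all add: odd_two_times_div_two_succ)
  qed
  moreover have "src = (\<lambda>i. if i < 2 * n \<and> odd i then Some (i - 1) else None)"
  proof
    fix i
    have "i \<in> dom src \<longleftrightarrow> i < 2 * n \<and> odd i"
      using parity(1) by (auto simp: dom recv_events_def n)
    then show "src i = (if i < 2 * n \<and> odd i then Some (i - 1) else None)"
      using parity(2)[of i] by (auto simp: n domIff)
  qed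
  ultimately have "e = exec_of_arrows ?u"
    unfolding exec_of_arrows_def e by simp
  with that show ?thesis .
qed

lemma exec_prefix_exec_of_arrows: "exec_prefix (exec_of_arrows u) (exec_of_arrows (u @ v))"
proof -
  \<comment> \<open>The receive events are computed as the domain of the source map, which has an
    explicit formula.\<close>
  have "dom (snd (exec_of_arrows u)) = recv_events (fst (exec_of_arrows u))"
    using exec_of_arrows_synch[of u]
    by (simp add: synch_def is_execution_def case_prod_unfold)
  then have "recv_events (concat (map arrow_actions u)) = {i. i < 2 * length u \<and> odd i}"
    by (simp add: exec_of_arrows_def dom_def conj_commute split: if_splits)
  then show ?thesis
    unfolding exec_prefix_def by (auto simp: exec_of_arrows_def restrict_map_def fun_eq_iff)
qed

section \<open>Transfer of realisability to the synchronous model\<close>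

lemma lang_subset_Arr:
  assumes "is_global_type G" and "w \<in> lang G"
  shows "set w \<subseteq> Arr"
proof -
  have sub: "delta G \<subseteq> states G \<times> insert None (Some ` Arr) \<times> states G"
    using assms(1) by (simp add: is_global_type_def is_dfa_def is_nfa_def)
  have "set w \<subseteq> Arr" if "run G s w t" for s t
    using that sub by induction auto
  with assms(2) show ?thesis
    by (auto simp: lang_def)
qed

lemma Exec_subset: "com' \<subseteq> com \<Longrightarrow> Exec S com' = Exec S com \<inter> com'"
  by (auto simp: Exec_def)

lemma Exec_global_subset: "com' \<subseteq> com \<Longrightarrow> Exec_global G com' = Exec_global G com \<inter> com'"
  by (auto simp: Exec_global_def Lin_def)

theorem theorem5p5:
  fixes com :: "('p::finite, 'm::finite) execution set"
    and G :: "('q, 'p, 'm) global_type"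
  assumes "comm_model com"
    and "synch \<subseteq> com"
    and "is_global_type G"
    and "df_realisable G com"
  shows "df_realisable G synch"
proof -
  have cc: "Exec (proj G) com = Exec_global G com" and df: "deadlock_free (proj G) com"
    using assms(4) by (auto simp: df_realisable_def)
  \<comment> \<open>Passing from \<open>com\<close> to \<open>synch\<close> intersects both sides of
    (CC) with \<open>synch\<close>.\<close>
  have cc': "Exec (proj G) synch = Exec_global G synch"
    using cc Exec_subset[OF assms(2)] Exec_global_subset[OF assms(2)] by metis
  have "\<exists>e'\<in>Exec (proj G) synch. exec_prefix e e'"
    if e: "e \<in> Exec (all_accepting (proj G)) synch" for e
  proof -
    obtain u where u: "e = exec_of_arrows u"
      using e synch_imp_exec_of_arrows[of e] by (auto simp: Exec_def)
    \<comment> \<open>As \<open>e\<close> also lies in \<open>com\<close>, deadlock-freedom there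
      extends it; the extension \<open>e'\<close> need not be synchronous.\<close>
    obtain e' where e': "e' \<in> Exec_global G com" "exec_prefix e e'"
      using df e Exec_subset[OF assms(2)] cc by (fastforce simp: deadlock_free_def)
    then obtain w where w: "w \<in> lang G" "msc_of e' = msc_of_arrows w"
      by (auto simp: Exec_global_def L_ex_def Lin_def)
    have "fst (msc_of e') = restrict_word (fst e')"
      by (simp add: msc_of_def split: prod.split)
    then have "restrict_word (fst e') = arrow_proj w"
      using w(2) fst_msc_of_arrows by metis
    moreover have "restrict_word (fst e) = arrow_proj u"
      by (simp add: u exec_of_arrows_def arrow_proj_def)
    ultimately have "prefix (arrow_proj u r) (arrow_proj w r)" for r
      using e'(2) by (metis exec_prefix_def prefix_def restrict_word_append)
    then obtain v where v: "msc_of_arrows (u @ v) = msc_of_arrows w"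
      using msc_of_arrows_extend lang_subset_Arr[OF assms(3) w(1)] by blast
    \<comment> \<open>\<open>u @ v\<close> itself need not belong to \<open>lang G\<close>; it
      suffices that its MSC is that of \<open>w\<close>.\<close>
    have "exec_of_arrows (u @ v) \<in> Exec_global G synch"
      using v w(1) exec_of_arrows_synch[of "u @ v"]
      by (auto simp: Exec_global_def L_ex_def Lin_def msc_of_arrows_def)
    then show ?thesis
      using cc' exec_prefix_exec_of_arrows u by blast
  qed
  with cc' show ?thesis
    by (simp add: df_realisable_def deadlock_free_def)
qed

end
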